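(* Let $n\ge1$. The metric $G$ on $P=\mathbb{R}^{2n+1}$ has, in the coordinates ordered as $(x^0;p_1,\dots,p_n;x^1,\dots,x^n)$, the Ricci tensor $$Ric(G)=\begin{pmatrix}-\frac n2&0&-\frac n2p_j\\0&0&\frac12\delta_{ij}\\-\frac n2p_i&\frac12\delta_{ij}&-\frac n2p_ip_j\end{pmatrix},$$ and the constant scalar curvature $\mathcal{R}(G)=\frac n2$.
   Context: $P=\mathbb{R}^{2n+1}$ has coordinates $(x^0;p_1,\dots,p_n;x^1,\dots,x^n)$ and contact form $\theta=dx^0+\sum_{i=1}^n p_i\,dx^i$. The Mrugala metric is the pseudo-Riemannian metric $G=2\sum_{k=1}^n dp_k\odot dx^k+\theta\otimes\theta$, where $dp_k\odot dx^k=\frac12(dp_k\otimes dx^k+dx^k\otimes dp_k)$. The block matrix has block rows and columns of sizes $1,n,n$, with $i$ the row index and $j$ the column index. Conventions: with the Christoffel symbols $\Gamma^\alpha_{\beta\gamma}$ of the Levi-Civita connection of $G$, the Ricci tensor is $R_{\alpha\beta}=\partial_\mu\Gamma^\mu_{\beta\alpha}-\partial_\beta\Gamma^\mu_{\mu\alpha}+\Gamma^\mu_{\mu\gamma}\Gamma^\gamma_{\beta\alpha}-\Gamma^\mu_{\beta\gamma}\Gamma^\gamma_{\mu\alpha}$, and the scalar curvature is $\mathcal{R}(G)=G^{\alpha\beta}R_{\beta\alpha}$. *)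

theory Defs
  imports "HOL-Analysis.Analysis"
begin

section \<open>Curvature of a metric on a coordinate space, in coordinates\<close>

type_synonym 'c covector = "(real, 'c) vec \<Rightarrow> real"
type_synonym 'c form2 = "(real, 'c) vec \<Rightarrow> (real, 'c) vec \<Rightarrow> real"
type_synonym 'c metric = "(real, 'c) vec \<Rightarrow> 'c form2"

definition coord_diff :: "'c::finite \<Rightarrow> 'c covector" where
  "coord_diff a v = v $ a"

definition tensor_prod :: "'c::finite covector \<Rightarrow> 'c covector \<Rightarrow> 'c form2" where
  "tensor_prod \<alpha> \<beta> u v = \<alpha> u * \<beta> v"

definition sym_prod :: "'c::finite covector \<Rightarrow> 'c covector \<Rightarrow> 'c form2" where
  "sym_prod \<alpha> \<beta> u v = 1 / 2 * (tensor_prod \<alpha> \<beta> u v + tensor_prod \<beta> \<alpha> u v)"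

definition pderiv_at :: "'c::finite \<Rightarrow> (real ^ 'c \<Rightarrow> real) \<Rightarrow> real ^ 'c \<Rightarrow> real" where
  "pderiv_at a f q = deriv (\<lambda>t. f (q + t *\<^sub>R axis a 1)) 0"

definition metric_matrix :: "'c::finite metric \<Rightarrow> real ^ 'c \<Rightarrow> real ^ 'c ^ 'c" where
  "metric_matrix g q = (\<chi> a b. g q (axis a 1) (axis b 1))"

abbreviation inverse_metric :: "'c::finite metric \<Rightarrow> real ^ 'c \<Rightarrow> real ^ 'c ^ 'c" where
  "inverse_metric g q \<equiv> matrix_inv (metric_matrix g q)"

text \<open>
  \<open>christoffel g a b c q\<close> is the symbol with upper index \<open>a\<close> and lower indices \<open>b, c\<close>; that this
  is the Levi-Civita connection is \<open>christoffel_unique\<close> below.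
\<close>

definition christoffel :: "'c::finite metric \<Rightarrow> 'c \<Rightarrow> 'c \<Rightarrow> 'c \<Rightarrow> real ^ 'c \<Rightarrow> real" where
  "christoffel g a b c q = 1 / 2 * (\<Sum>m\<in>UNIV. inverse_metric g q $ a $ m *
     (pderiv_at b (\<lambda>x. metric_matrix g x $ m $ c) q
    + pderiv_at c (\<lambda>x. metric_matrix g x $ m $ b) q
    - pderiv_at m (\<lambda>x. metric_matrix g x $ b $ c) q))"

definition ricci :: "'c::finite metric \<Rightarrow> real ^ 'c \<Rightarrow> real ^ 'c ^ 'c" where
  "ricci g q = (\<chi> a b.
     (\<Sum>m\<in>UNIV. pderiv_at m (christoffel g m b a) q)
   - pderiv_at b (\<lambda>x. \<Sum>m\<in>UNIV. christoffel g m m a x) q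
   + (\<Sum>m\<in>UNIV. \<Sum>c\<in>UNIV. christoffel g m m c q * christoffel g c b a q)
   - (\<Sum>m\<in>UNIV. \<Sum>c\<in>UNIV. christoffel g m b c q * christoffel g c m a q))"

definition scalar_curvature :: "'c::finite metric \<Rightarrow> real ^ 'c \<Rightarrow> real" where
  "scalar_curvature g q =
     (\<Sum>a\<in>UNIV. \<Sum>b\<in>UNIV. inverse_metric g q $ a $ b * ricci g q $ b $ a)"

text \<open>
  Symmetry of the lower indices (no torsion) together with metric compatibility at \<open>q\<close>
  characterises the Christoffel symbols.
\<close>

lemma christoffel_unique:
  fixes g :: "'c::finite metric" and \<Gamma> :: "'c \<Rightarrow> 'c \<Rightarrow> 'c \<Rightarrow> real"
  assumes sym: "\<And>x a b. metric_matrix g x $ a $ b = metric_matrix g x $ b $ a"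
    and inv: "invertible (metric_matrix g q)"
  shows "(\<forall>a b c. \<Gamma> a b c = \<Gamma> a c b) \<and>
         (\<forall>a b c. pderiv_at c (\<lambda>x. metric_matrix g x $ a $ b) q =
            (\<Sum>m\<in>UNIV. \<Gamma> m c a * metric_matrix g q $ m $ b)
          + (\<Sum>m\<in>UNIV. \<Gamma> m c b * metric_matrix g q $ a $ m))
     \<longleftrightarrow> (\<forall>a b c. \<Gamma> a b c = christoffel g a b c q)"
proof -
  let ?G = "metric_matrix g q"
  define D where "D c a b = pderiv_at c (\<lambda>x. metric_matrix g x $ a $ b) q" for a b c
  define K where "K m b c = D b m c + D c m b - D m b c" for m b c
  have Dsym: "D c a b = D c b a" for a b c
    unfolding D_def by (subst sym) simp
  have Ksym: "K m b c = K m c b" for m b c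
    unfolding K_def using Dsym[of m b c] by simp
  have IG: "matrix_inv ?G ** ?G = mat 1" and GI: "?G ** matrix_inv ?G = mat 1"
    using someI_ex[OF inv[unfolded invertible_def]] by (simp_all add: matrix_inv_def)
  have christ: "christoffel g a b c q = 1/2 * (matrix_inv ?G *v (\<chi> m. K m b c)) $ a" for a b c
    by (simp add: christoffel_def K_def D_def matrix_vector_mult_def)
  have Gchrist: "(?G *v (\<chi> a. \<Gamma> a b c)) $ m = 1/2 * K m b c"
    if "\<And>a. \<Gamma> a b c = christoffel g a b c q" for m b c
  proof -
    have "(\<chi> a. \<Gamma> a b c) = (1/2) *\<^sub>R (matrix_inv ?G *v (\<chi> m. K m b c))"
      by (simp add: vec_eq_iff that christ)
    then have "?G *v (\<chi> a. \<Gamma> a b c) = (1/2) *\<^sub>R ((?G ** matrix_inv ?G) *v (\<chi> m. K m b c))"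
      by (simp add: matrix_vector_mult_scaleR matrix_vector_mul_assoc)
    then show ?thesis by (simp add: GI)
  qed
  have lower: "(\<Sum>m\<in>UNIV. \<Gamma> m c a * ?G $ m $ b) = (?G *v (\<chi> m. \<Gamma> m c a)) $ b"
    "(\<Sum>m\<in>UNIV. \<Gamma> m c b * ?G $ a $ m) = (?G *v (\<chi> m. \<Gamma> m c b)) $ a" for a b c
    by (auto simp: matrix_vector_mult_def sym[of q _ b] mult.commute intro!: sum.cong)
  show ?thesis
    unfolding lower D_def[symmetric]
  proof (intro iffI conjI allI; (elim conjE)?)
    fix a b c
    assume S: "\<forall>a b c. \<Gamma> a b c = \<Gamma> a c b"
      and C: "\<forall>a b c. D c a b = (?G *v (\<chi> m. \<Gamma> m c a)) $ b + (?G *v (\<chi> m. \<Gamma> m c b)) $ a"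
    have S': "(\<chi> m. \<Gamma> m u v) = (\<chi> m. \<Gamma> m v u)" for u v
      using S by simp
    have "(?G *v (\<chi> m. \<Gamma> m b c)) $ m = 1/2 * K m b c" for m
      unfolding K_def using C S'[of m b] S'[of m c] S'[of b c] by simp
    then have "?G *v (\<chi> m. \<Gamma> m b c) = (1/2) *\<^sub>R (\<chi> m. K m b c)"
      by (simp add: vec_eq_iff)
    then have "(matrix_inv ?G ** ?G) *v (\<chi> m. \<Gamma> m b c) = (1/2) *\<^sub>R (matrix_inv ?G *v (\<chi> m. K m b c))"
      by (simp add: matrix_vector_mult_scaleR flip: matrix_vector_mul_assoc)
    then show "\<Gamma> a b c = christoffel g a b c q"
      unfolding christ IG by (simp add: vec_eq_iff)
  next
    fix a b c
    assume E: "\<forall>a b c. \<Gamma> a b c = christoffel g a b c q"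
    show "\<Gamma> a b c = \<Gamma> a c b"
      using E by (simp only: christ Ksym[of _ b c])
    show "D c a b = (?G *v (\<chi> m. \<Gamma> m c a)) $ b + (?G *v (\<chi> m. \<Gamma> m c b)) $ a"
      using Gchrist[of c a b] Gchrist[of c b a] E Dsym[of c b a] Dsym[of a b c] Dsym[of b c a]
      unfolding K_def by simp
  qed
qed


section \<open>The Mrugala metric\<close>

text \<open>
  The index type \<open>'n\<close> has \<open>n\<close> elements, so \<open>real ^ 'n pidx\<close> is the space of dimension \<open>2n + 1\<close>;
  the summands of \<open>'n pidx\<close> index the blocks \<open>x\<^sup>0\<close>, \<open>p\<^sub>1, \<dots>, p\<^sub>n\<close>, \<open>x\<^sup>1, \<dots>, x\<^sup>n\<close> in this order.
\<close>

type_synonym 'n pidx = "unit + 'n + 'n"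

abbreviation idx_0 :: "'n pidx" where "idx_0 \<equiv> Inl ()"
abbreviation idx_p :: "'n \<Rightarrow> 'n pidx" where "idx_p i \<equiv> Inr (Inl i)"
abbreviation idx_x :: "'n \<Rightarrow> 'n pidx" where "idx_x i \<equiv> Inr (Inr i)"

definition contact_form :: "(real, 'n::finite pidx) vec \<Rightarrow> 'n pidx covector" where
  "contact_form q v = coord_diff idx_0 v + (\<Sum>i\<in>UNIV. q $ idx_p i * coord_diff (idx_x i) v)"

definition mrugala_metric :: "'n::finite pidx metric" where
  "mrugala_metric q u v =
     2 * (\<Sum>k\<in>UNIV. sym_prod (coord_diff (idx_p k)) (coord_diff (idx_x k)) u v)
     + tensor_prod (contact_form q) (contact_form q) u v"

text \<open>
  The metric is symmetric and nondegenerate, so \<open>christoffel_unique\<close> applies to it and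
  \<open>matrix_inv\<close> is its genuine inverse.
\<close>

lemma mrugala_metric_sym:
  "metric_matrix mrugala_metric q $ a $ b = metric_matrix mrugala_metric q $ b $ a"
  by (simp add: metric_matrix_def mrugala_metric_def sym_prod_def tensor_prod_def
      mult.commute add.commute)

lemma linear_mrugala_metric: "linear (mrugala_metric q u)"
proof -
  have "linear (contact_form q)"
    unfolding contact_form_def coord_diff_def
    by (rule linearI) (simp_all add: algebra_simps sum.distrib sum_distrib_left)
  then show ?thesis
    unfolding mrugala_metric_def sym_prod_def tensor_prod_def coord_diff_def
    by (intro linearI)
      (simp_all add: linear_add linear_scale algebra_simps sum.distrib sum_distrib_left)
qed

lemma mrugala_metric_axis:
  fixes q :: "(real, 'n::finite pidx) vec"
  shows "mrugala_metric q (axis idx_0 1) v = contact_form q v"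
    and "mrugala_metric q (axis (idx_p k) 1) v = v $ idx_x k"
    and "mrugala_metric q (axis (idx_x k) 1) v = v $ idx_p k + q $ idx_p k * contact_form q v"
proof -
  have delta: "(\<Sum>i\<in>UNIV. f i * (if i = k then 1 else 0)) = f k"
    "(\<Sum>i\<in>UNIV. (if i = k then 1 else 0) * f i) = f k" for f :: "'n \<Rightarrow> real"
    by (simp_all add: mult_delta_right mult_delta_left)
  note defs = mrugala_metric_def sym_prod_def tensor_prod_def coord_diff_def
    sum_divide_distrib[symmetric]
  have "contact_form q (axis idx_0 1) = 1" "contact_form q (axis (idx_p k) 1) = 0"
    "contact_form q (axis (idx_x k) 1) = q $ idx_p k"
    by (simp_all add: contact_form_def coord_diff_def axis_def delta)
  then show "mrugala_metric q (axis idx_0 1) v = contact_form q v"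
    "mrugala_metric q (axis (idx_p k) 1) v = v $ idx_x k"
    "mrugala_metric q (axis (idx_x k) 1) v = v $ idx_p k + q $ idx_p k * contact_form q v"
    by (simp_all add: defs) (simp_all add: axis_def delta)
qed

lemma mrugala_metric_invertible:
  fixes q :: "(real, 'n::finite pidx) vec"
  shows "invertible (metric_matrix mrugala_metric q)"
proof -
  let ?M = "metric_matrix mrugala_metric q"
  have lin: "(?M *v v) $ a = mrugala_metric q (axis a 1) v" for a v
  proof -
    have "v = (\<Sum>b\<in>UNIV. v $ b *\<^sub>R axis b 1)"
      using basis_expansion[of v] by (simp add: scalar_mult_eq_scaleR)
    then have "mrugala_metric q (axis a 1) v
        = mrugala_metric q (axis a 1) (\<Sum>b\<in>UNIV. v $ b *\<^sub>R axis b 1)"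
      by (rule arg_cong)
    then show ?thesis
      by (simp add: linear_sum[OF linear_mrugala_metric] linear_scale[OF linear_mrugala_metric]
          matrix_vector_mult_def metric_matrix_def mult.commute)
  qed
  have "v = 0" if "?M *v v = 0" for v
  proof -
    have 0: "mrugala_metric q (axis a 1) v = 0" for a
      using lin[of v a] that by simp
    have th: "contact_form q v = 0" and xs: "v $ idx_x k = 0" for k
      using 0 mrugala_metric_axis(1,2)[of q] by metis+
    have ps: "v $ idx_p k = 0" for k
      using 0[of "idx_x k"] th by (simp add: mrugala_metric_axis(3))
    have x0: "v $ idx_0 = 0"
      using th xs by (simp add: contact_form_def coord_diff_def)
    show "v = 0"
      unfolding vec_eq_iff
    proof
      fix a :: "'n pidx"
      show "v $ a = 0 $ a"
      proof (cases a)
        case (Inl u) then show ?thesis using x0 by simp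
      next
        case (Inr b) then show ?thesis using xs ps by (cases b) simp_all
      qed
    qed
  qed
  then show ?thesis
    using invertible_left_inverse matrix_left_invertible_ker by blast
qed

end

theory Submission
  imports Defs
begin

text \<open>In closed form, Ric = -(n/2) \<theta> \<otimes> \<theta> + sum over k of dp_k \<odot>
  dx^k. The coframe \<theta>, dp_k, dx^k differs from the coordinate one by a unipotent matrix, so G
  has constant determinant and an explicit inverse (\<open>inverse_mrugala\<close>). Constant
  determinant kills the contracted symbols (\<open>christoffel_mrugala_trace\<close>), and with them
  two of the four Ricci terms. The coefficients of G depend on the p_k alone, so only p-derivatives
  survive in the divergence term. What is left (\<open>ricci_mrugala\<close>) is evaluated block by
  block from the tables of Christoffel symbols.\<close>

lemma sum_pidx:
  fixes f :: "'n::finite pidx \<Rightarrow> 'a::comm_monoid_add"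
  shows "(\<Sum>a\<in>UNIV. f a) = f idx_0 + ((\<Sum>k\<in>UNIV. f (idx_p k)) + (\<Sum>k\<in>UNIV. f (idx_x k)))"
proof -
  have "(\<Sum>u\<in>UNIV. f (Inl u)) = f idx_0"
    by (simp add: UNIV_unit)
  then show ?thesis
    using sum.Plus[of "UNIV :: unit set" "UNIV :: ('n + 'n) set" f]
      sum.Plus[of "UNIV :: 'n set" "UNIV :: 'n set" "f \<circ> Inr"]
    by simp
qed

lemma pidx_cases [case_names zero p x]:
  obtains "a = idx_0" | i where "a = idx_p i" | i where "a = idx_x i"
proof (cases a)
  case (Inl u)
  then show ?thesis using that(1) by simp
next
  case (Inr b)
  then show ?thesis using that(2,3) by (cases b) auto
qed

lemma minus_delta: "- (if P then x else 0) = (if P then - x else (0 :: 'a::group_add))"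
  by simp

lemma divide_delta: "(if P then x else 0) / c = (if P then x / c else (0 :: 'a::division_ring))"
  by simp

text \<open>Needed when both indices of a Kronecker delta are fixed and the sum runs over a third
  one.\<close>

lemma sum_delta_const: "(\<Sum>k\<in>A. if P then f k else 0) = (if P then (\<Sum>k\<in>A. f k) else 0)"
  by simp

lemmas delta_simps = mult_delta_left mult_delta_right minus_delta divide_delta sum_delta_const

lemma pderiv_at_eqI:
  assumes "((\<lambda>t. f (q + t *\<^sub>R axis a 1)) has_real_derivative D) (at 0)"
  shows "pderiv_at a f q = D"
  using assms unfolding pderiv_at_def by (rule DERIV_imp_deriv)

lemma pderiv_at_const: "pderiv_at a (\<lambda>x. c) q = 0"
  by (rule pderiv_at_eqI) simp

lemma pderiv_at_coord: "pderiv_at a (\<lambda>x. x $ b) q = (if a = b then 1 else 0)"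
  by (rule pderiv_at_eqI) (auto simp: axis_def intro!: derivative_eq_intros)

lemma pderiv_at_coord_divide: "pderiv_at a (\<lambda>x. x $ b / c) q = (if a = b then 1 / c else 0)"
  by (rule pderiv_at_eqI) (auto simp: axis_def divide_inverse intro!: derivative_eq_intros)

lemma pderiv_at_coord_mult:
  "pderiv_at a (\<lambda>x. x $ b * x $ c) q = (if a = b then q $ c else 0) + (if a = c then q $ b else 0)"
  by (rule pderiv_at_eqI) (auto simp: axis_def intro!: derivative_eq_intros)

lemma pderiv_at_delta:
  "pderiv_at a (\<lambda>x. if P then f x else 0) q = (if P then pderiv_at a f q else 0)"
  by (simp add: pderiv_at_const)

lemma pderiv_at_indep:
  assumes "\<And>t. f (q + t *\<^sub>R axis a 1) = f q"
  shows "pderiv_at a f q = 0"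
  by (simp add: pderiv_at_def assms)

lemmas pderiv_at_simps =
  pderiv_at_const pderiv_at_coord pderiv_at_coord_divide pderiv_at_coord_mult pderiv_at_delta

text \<open>\<open>matrix_inv\<close> picks some two-sided inverse. For square matrices the left
  inverse B is also a right one, so the choice has a witness, and associativity forces the chosen
  inverse to be B.\<close>

lemma matrix_inv_eqI:
  fixes A B :: "real ^ 'c ^ 'c::finite"
  assumes "B ** A = mat 1"
  shows "matrix_inv A = B"
proof -
  have AB: "A ** B = mat 1"
    using assms matrix_left_right_inverse by blast
  have "A ** matrix_inv A = mat 1"
    unfolding matrix_inv_def by (rule conjunct1[OF someI[of _ B]]) (use AB assms in blast)
  then have "(B ** A) ** matrix_inv A = B"
    unfolding matrix_mul_assoc[symmetric] by simp
  then show ?thesis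
    by (simp add: assms)
qed

lemma contact_form_axis:
  fixes q :: "(real, 'n::finite pidx) vec"
  shows "contact_form q (axis idx_0 1) = 1"
    and "contact_form q (axis (idx_p k) 1) = 0"
    and "contact_form q (axis (idx_x k) 1) = q $ idx_p k"
  by (simp_all add: contact_form_def coord_diff_def axis_def delta_simps)

lemma mrugala_matrix:
  fixes q :: "(real, 'n::finite pidx) vec"
  defines "G \<equiv> metric_matrix mrugala_metric q"
  shows "G $ idx_0 $ idx_0 = 1"
    and "G $ idx_0 $ idx_p j = 0"
    and "G $ idx_0 $ idx_x j = q $ idx_p j"
    and "G $ idx_p i $ idx_0 = 0"
    and "G $ idx_p i $ idx_p j = 0"
    and "G $ idx_p i $ idx_x j = (if i = j then 1 else 0)"
    and "G $ idx_x i $ idx_0 = q $ idx_p i"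
    and "G $ idx_x i $ idx_p j = (if i = j then 1 else 0)"
    and "G $ idx_x i $ idx_x j = q $ idx_p i * q $ idx_p j"
  by (simp_all add: G_def metric_matrix_def mrugala_metric_axis contact_form_axis)
    (auto simp: axis_def)

text \<open>
  The vectors \<open>\<partial>/\<partial>x\<^sup>0\<close>, \<open>\<partial>/\<partial>p\<^sub>k\<close>, \<open>\<partial>/\<partial>x\<^sup>k - p\<^sub>k \<partial>/\<partial>x\<^sup>0\<close> are dual to \<open>\<theta>\<close>, \<open>dp\<^sub>k\<close>, \<open>dx\<^sup>k\<close>, so the
  inverse is \<open>\<partial>\<^sub>0 \<otimes> \<partial>\<^sub>0 + 2 \<Sum>\<^sub>k \<partial>/\<partial>p\<^sub>k \<odot> (\<partial>/\<partial>x\<^sup>k - p\<^sub>k \<partial>\<^sub>0)\<close>.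
\<close>

fun mrugala_inverse :: "(real, 'n::finite pidx) vec \<Rightarrow> 'n pidx \<Rightarrow> 'n pidx \<Rightarrow> real" where
  "mrugala_inverse q (Inl _) (Inl _) = 1"
| "mrugala_inverse q (Inl _) (Inr (Inl j)) = - q $ idx_p j"
| "mrugala_inverse q (Inl _) (Inr (Inr j)) = 0"
| "mrugala_inverse q (Inr (Inl i)) (Inl _) = - q $ idx_p i"
| "mrugala_inverse q (Inr (Inl i)) (Inr (Inl j)) = 0"
| "mrugala_inverse q (Inr (Inl i)) (Inr (Inr j)) = (if i = j then 1 else 0)"
| "mrugala_inverse q (Inr (Inr i)) (Inl _) = 0"
| "mrugala_inverse q (Inr (Inr i)) (Inr (Inl j)) = (if i = j then 1 else 0)"
| "mrugala_inverse q (Inr (Inr i)) (Inr (Inr j)) = 0"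

lemma inverse_mrugala:
  "inverse_metric mrugala_metric q $ a $ b = mrugala_inverse q a b"
proof -
  have "(\<chi> a b. mrugala_inverse q a b) ** metric_matrix mrugala_metric q = mat 1"
  proof (simp add: vec_eq_iff, intro allI)
    fix a b
    show "((\<chi> a b. mrugala_inverse q a b) ** metric_matrix mrugala_metric q) $ a $ b = mat 1 $ a $ b"
      by (cases a rule: pidx_cases; cases b rule: pidx_cases)
        (simp_all add: matrix_matrix_mult_def mat_def sum_pidx mrugala_matrix delta_simps)
  qed
  from matrix_inv_eqI[OF this] show ?thesis by simp
qed

lemmas christoffel_simps = fun_eq_iff christoffel_def inverse_mrugala mrugala_matrix
  sum_pidx pderiv_at_simps distrib_left right_diff_distrib sum.distrib sum_subtractf delta_simps

lemma christoffel_sym: "christoffel mrugala_metric a b c = christoffel mrugala_metric a c b"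
  by (simp add: fun_eq_iff christoffel_def mrugala_metric_sym[of _ b c] add.commute)

text \<open>Here and in the next two tables the equations are between functions of the point,
  because \<open>ricci\<close> differentiates the symbols. Each unordered pair of lower indices
  occurs once; \<open>christoffel_sym\<close> supplies the other order.\<close>

lemma christoffel_mrugala_0:
  fixes i j :: "'n::finite"
  shows "christoffel mrugala_metric idx_0 idx_0 (idx_0 :: 'n pidx) = (\<lambda>q. 0)"
    and "christoffel mrugala_metric idx_0 idx_0 (idx_p j) = (\<lambda>q. 0)"
    and "christoffel mrugala_metric idx_0 idx_0 (idx_x j) = (\<lambda>q. q $ idx_p j / 2)"
    and "christoffel mrugala_metric idx_0 (idx_p i) (idx_p j) = (\<lambda>q. 0)"
    and "christoffel mrugala_metric idx_0 (idx_p i) (idx_x j) = (\<lambda>q. if i = j then 1 / 2 else 0)"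
    and "christoffel mrugala_metric idx_0 (idx_x i) (idx_x j) = (\<lambda>q. q $ idx_p i * q $ idx_p j)"
  by (simp_all add: christoffel_simps)

lemma christoffel_mrugala_p:
  fixes i j l :: "'n::finite"
  shows "christoffel mrugala_metric (idx_p l) idx_0 idx_0 = (\<lambda>q. 0)"
    and "christoffel mrugala_metric (idx_p l) idx_0 (idx_p j) = (\<lambda>q. if l = j then 1 / 2 else 0)"
    and "christoffel mrugala_metric (idx_p l) idx_0 (idx_x j) = (\<lambda>q. 0)"
    and "christoffel mrugala_metric (idx_p l) (idx_p i) (idx_p j) = (\<lambda>q. 0)"
    and "christoffel mrugala_metric (idx_p l) (idx_p i) (idx_x j) =
      (\<lambda>q. if l = i then q $ idx_p j / 2 else 0)"
    and "christoffel mrugala_metric (idx_p l) (idx_x i) (idx_x j) = (\<lambda>q. 0)"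
  by (simp_all add: christoffel_simps)

lemma christoffel_mrugala_x:
  fixes i j l :: "'n::finite"
  shows "christoffel mrugala_metric (idx_x l) idx_0 idx_0 = (\<lambda>q. 0)"
    and "christoffel mrugala_metric (idx_x l) idx_0 (idx_p j) = (\<lambda>q. 0)"
    and "christoffel mrugala_metric (idx_x l) idx_0 (idx_x j) = (\<lambda>q. if l = j then - 1 / 2 else 0)"
    and "christoffel mrugala_metric (idx_x l) (idx_p i) (idx_p j) = (\<lambda>q. 0)"
    and "christoffel mrugala_metric (idx_x l) (idx_p i) (idx_x j) = (\<lambda>q. 0)"
    and "christoffel mrugala_metric (idx_x l) (idx_x i) (idx_x j) =
      (\<lambda>q. (if l = i then - q $ idx_p j / 2 else 0) + (if l = j then - q $ idx_p i / 2 else 0))"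
  by (simp_all add: christoffel_simps)

lemmas christoffel_mrugala =
  christoffel_mrugala_0 christoffel_mrugala_p christoffel_mrugala_x
  christoffel_mrugala_0(2)[THEN trans[OF christoffel_sym]]
  christoffel_mrugala_0(3)[THEN trans[OF christoffel_sym]]
  christoffel_mrugala_0(5)[THEN trans[OF christoffel_sym]]
  christoffel_mrugala_p(2)[THEN trans[OF christoffel_sym]]
  christoffel_mrugala_p(3)[THEN trans[OF christoffel_sym]]
  christoffel_mrugala_p(5)[THEN trans[OF christoffel_sym]]
  christoffel_mrugala_x(2)[THEN trans[OF christoffel_sym]]
  christoffel_mrugala_x(3)[THEN trans[OF christoffel_sym]]
  christoffel_mrugala_x(5)[THEN trans[OF christoffel_sym]]

text \<open>The determinant of the metric is constant, so the contracted symbols vanish.\<close>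

lemma christoffel_mrugala_trace: "(\<Sum>m\<in>UNIV. christoffel mrugala_metric m m a q) = 0"
  by (cases a rule: pidx_cases) (simp_all add: sum_pidx christoffel_mrugala sum.distrib sum_subtractf sum_negf delta_simps)

text \<open>Translations in x^0 and in the x^k preserve G, hence also its connection.\<close>

lemma pderiv_at_christoffel_mrugala:
  "pderiv_at idx_0 (christoffel mrugala_metric a b c) q = 0"
  "pderiv_at (idx_x k) (christoffel mrugala_metric a b c) q = 0"
  by (rule pderiv_at_indep, cases a rule: pidx_cases; cases b rule: pidx_cases;
      cases c rule: pidx_cases; simp add: christoffel_mrugala axis_def)+

lemma ricci_mrugala:
  fixes q :: "(real, 'n::finite pidx) vec"
  shows "ricci mrugala_metric q $ a $ b =
      (\<Sum>k\<in>UNIV. pderiv_at (idx_p k) (christoffel mrugala_metric (idx_p k) b a) q)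
    - (\<Sum>m\<in>UNIV. \<Sum>c\<in>UNIV. christoffel mrugala_metric m b c q * christoffel mrugala_metric c m a q)"
proof -
  have "(\<Sum>m\<in>UNIV. \<Sum>c\<in>UNIV. christoffel mrugala_metric m m c q * christoffel mrugala_metric c b a q) = 0"
    \<comment> \<open>With m as the inner index, the second symbol factors out and leaves the
      vanishing trace.\<close>
    by (subst sum.swap) (simp add: christoffel_mrugala_trace flip: sum_distrib_right)
  moreover have "(\<Sum>m\<in>UNIV. pderiv_at m (christoffel mrugala_metric m b a) q) =
      (\<Sum>k\<in>UNIV. pderiv_at (idx_p k) (christoffel mrugala_metric (idx_p k) b a) q)"
    by (simp add: sum_pidx pderiv_at_christoffel_mrugala)
  ultimately show ?thesis
    by (simp add: ricci_def christoffel_mrugala_trace pderiv_at_const)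
qed

text \<open>The divergence term contributes only to the mixed p-x blocks: the symbol with upper
  index p_k and lower indices p_i, x^j is p_j/2 if k = i and 0 otherwise, so its divergence is half
  the Kronecker delta of i and j. In these blocks the quadratic terms cancel (1/4 - 1/4). The
  quadratic term alone produces -(n/2) \<theta> \<otimes> \<theta>; in the corner, for instance, the
  p and x indices each give n/4.\<close>

lemma ricci_mrugala_block:
  fixes q :: "(real, 'n::finite pidx) vec" and i j :: 'n
  defines "R \<equiv> ricci mrugala_metric q"
  shows "R $ idx_0 $ idx_0 = - real CARD('n) / 2"
    and "R $ idx_0 $ idx_p j = 0"
    and "R $ idx_0 $ idx_x j = - real CARD('n) / 2 * q $ idx_p j"
    and "R $ idx_p i $ idx_0 = 0"
    and "R $ idx_p i $ idx_p j = 0"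
    and "R $ idx_p i $ idx_x j = 1 / 2 * (if i = j then 1 else 0)"
    and "R $ idx_x i $ idx_0 = - real CARD('n) / 2 * q $ idx_p i"
    and "R $ idx_x i $ idx_p j = 1 / 2 * (if i = j then 1 else 0)"
    and "R $ idx_x i $ idx_x j = - real CARD('n) / 2 * q $ idx_p i * q $ idx_p j"
  unfolding R_def ricci_mrugala
  by (simp_all add: sum_pidx christoffel_mrugala pderiv_at_simps delta_simps sum.distrib sum_subtractf sum_negf algebra_simps
      cong: if_cong)

theorem proposition1:
  fixes q :: "(real, 'n::finite pidx) vec"
  shows "(\<forall>i j :: 'n.
      ricci mrugala_metric q $ idx_0 $ idx_0 = - real CARD('n) / 2
    \<and> ricci mrugala_metric q $ idx_0 $ idx_p j = 0
    \<and> ricci mrugala_metric q $ idx_0 $ idx_x j = - real CARD('n) / 2 * q $ idx_p j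
    \<and> ricci mrugala_metric q $ idx_p i $ idx_0 = 0
    \<and> ricci mrugala_metric q $ idx_p i $ idx_p j = 0
    \<and> ricci mrugala_metric q $ idx_p i $ idx_x j = 1 / 2 * (if i = j then 1 else 0)
    \<and> ricci mrugala_metric q $ idx_x i $ idx_0 = - real CARD('n) / 2 * q $ idx_p i
    \<and> ricci mrugala_metric q $ idx_x i $ idx_p j = 1 / 2 * (if i = j then 1 else 0)
    \<and> ricci mrugala_metric q $ idx_x i $ idx_x j = - real CARD('n) / 2 * q $ idx_p i * q $ idx_p j)
    \<and> scalar_curvature mrugala_metric q = real CARD('n) / 2"
proof -
  have "scalar_curvature mrugala_metric q = real CARD('n) / 2"
    \<comment> \<open>The corner contributes -n/2 and each of the two mixed p-x blocks n/2; the
      entries -p_k of the inverse meet zero entries of Ric.\<close>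
    unfolding scalar_curvature_def inverse_mrugala
    by (simp add: sum_pidx ricci_mrugala_block delta_simps)
  then show ?thesis
    by (simp add: ricci_mrugala_block)
qed

end
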